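(* Let $n$ be a positive integer. The unitary Cayley graph $X_n$ admits pretty good fractional revival if and only if $n=2$ or $n=2p$ for some prime $p$.
   Context: The unitary Cayley graph $X_n$ is the simple undirected graph with vertex set $\mathbb{Z}_n$ in which two distinct vertices $a,b$ are adjacent if and only if $a-b\equiv u \pmod n$ for some integer $u$ with $1\le u\le n-1$ and $\gcd(u,n)=1$. For a finite simple undirected graph $\Gamma$ with adjacency matrix $A$, the transition matrix is $H(t)=\exp(-\mathbf{i}tA)$, $t\in\mathbb{R}$, where $\mathbf{i}=\sqrt{-1}$. For a vertex $a$, $\mathbf{e}_a$ is the standard basis column vector indexed by the vertices with entry $1$ at $a$ and $0$ elsewhere. $\Gamma$ admits pretty good fractional revival (PGFR) from a vertex $a$ to another vertex $b\ne a$ if there is a real sequence $\{t_k\}$ such that $\lim_{k\to\infty}H(t_k)\mathbf{e}_a=\alpha\mathbf{e}_a+\beta\mathbf{e}_b$ for some complex numbers $\alpha,\beta$ with $\beta\neq 0$ and $|\alpha|^2+|\beta|^2=1$. $\Gamma$ admits PGFR if it does so from some vertex $a$ to some other vertex $b$. *)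

theory Defs
  imports
    Complex_Main
    "HOL-Number_Theory.Cong"
    "Graph_Theory.Pair_Digraph"
    "Jordan_Normal_Form.Matrix"
begin

text \<open>
  Simple graphs are instances of the locale \<^locale>\<open>pair_graph\<close>: finite, loop-free digraphs
  with a symmetric arc relation. Below, the vertex set of a graph on \<open>n\<close> vertices is
  \<open>{0..<n}\<close>, so that vertices index the rows and columns of matrices directly; for
  \<open>unitary_cayley n\<close> these are the standard representatives of \<open>\<int>\<^sub>n\<close>.
\<close>

definition unitary_cayley :: "nat \<Rightarrow> nat pair_pre_digraph" where
  "unitary_cayley n =
     \<lparr> pverts = {0..<n},
       parcs = {(a, b). a < n \<and> b < n \<and> a \<noteq> b \<and>
         (\<exists>u::int. 1 \<le> u \<and> u \<le> int n - 1 \<and> gcd u (int n) = 1 \<and>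
                   [int a - int b = u] (mod int n))} \<rparr>"

lemma pair_graph_unitary_cayley: "pair_graph (unitary_cayley n)"
proof -
  have swap: "(b, a) \<in> parcs (unitary_cayley n)" if "(a, b) \<in> parcs (unitary_cayley n)" for a b
  proof -
    from that obtain u :: int where *: "a < n" "b < n" "a \<noteq> b" and u: "1 \<le> u" "u \<le> int n - 1"
      "gcd u (int n) = 1" "[int a - int b = u] (mod int n)"
      by (auto simp: unitary_cayley_def)
    have "gcd (int n - u) (int n) = 1"
      using u(3) by (metis gcd.commute gcd_diff1 gcd_diff2)
    moreover have "[int b - int a = int n - u] (mod int n)"
      using u(4) by (metis cong_diff cong_0_iff cong_minus_minus_iff cong_sym diff_0 dvd_refl
          minus_diff_eq)
    moreover have "1 \<le> int n - u" "int n - u \<le> int n - 1" using u by auto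
    ultimately show ?thesis using * unfolding unitary_cayley_def by auto
  qed
  have "finite (parcs (unitary_cayley n))"
    by (rule finite_subset[of _ "{0..<n} \<times> {0..<n}"]) (auto simp: unitary_cayley_def)
  with swap show ?thesis
    by unfold_locales (auto simp: unitary_cayley_def symmetric_def sym_def)
qed

definition adj_mat :: "nat pair_pre_digraph \<Rightarrow> complex mat" where
  "adj_mat G = mat (card (pverts G)) (card (pverts G))
     (\<lambda>(i, j). if (i, j) \<in> parcs G then 1 else 0)"

text \<open>
  The exponential of a square matrix, its power series being summed entrywise;
  \<open>summable_mat_exp\<close> shows that every entry converges absolutely.
\<close>

definition mat_exp :: "complex mat \<Rightarrow> complex mat" where
  "mat_exp M = mat (dim_row M) (dim_row M) (\<lambda>(i, j). \<Sum>k. (M ^\<^sub>m k) $$ (i, j) / fact k)"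

lemma norm_pow_mat_le:
  fixes M :: "complex mat"
  assumes M: "M \<in> carrier_mat n n"
    and B: "\<And>i j. i < n \<Longrightarrow> j < n \<Longrightarrow> norm (M $$ (i, j)) \<le> B"
    and "i < n" "j < n"
  shows "norm ((M ^\<^sub>m k) $$ (i, j)) \<le> (real n * B) ^ k"
  using assms(3,4)
proof (induction k arbitrary: j)
  case 0
  then show ?case using M by auto
next
  case (Suc k)
  have B0: "0 \<le> B" using B[of i i] Suc.prems norm_ge_zero order_trans by blast
  have "(M ^\<^sub>m Suc k) $$ (i, j) = (\<Sum>l\<in>{0..<n}. (M ^\<^sub>m k) $$ (i, l) * M $$ (l, j))"
    using M Suc.prems by (simp add: scalar_prod_def pow_mat_dim)
  also have "norm \<dots> \<le> (\<Sum>l\<in>{0..<n}. (real n * B) ^ k * B)"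
    by (rule sum_norm_le) (use Suc B B0 in \<open>auto simp: norm_mult intro!: mult_mono\<close>)
  also have "\<dots> = (real n * B) ^ Suc k" by (simp add: algebra_simps)
  finally show ?case .
qed

lemma summable_mat_exp:
  fixes M :: "complex mat"
  assumes M: "M \<in> carrier_mat n n" and ij: "i < n" "j < n"
  shows "summable (\<lambda>k. norm ((M ^\<^sub>m k) $$ (i, j) / fact k))"
proof -
  define B where "B = Max ((\<lambda>(i, j). norm (M $$ (i, j))) ` ({0..<n} \<times> {0..<n}))"
  have B: "norm (M $$ (i, j)) \<le> B" if "i < n" "j < n" for i j
    unfolding B_def by (rule Max_ge) (use that in auto)
  show ?thesis
  proof (rule summable_comparison_test')
    show "summable (\<lambda>k. (real n * B) ^ k /\<^sub>R fact k)" by (rule summable_exp_generic)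
    show "norm (norm ((M ^\<^sub>m k) $$ (i, j) / fact k)) \<le> (real n * B) ^ k /\<^sub>R fact k"
      if "k \<ge> 0" for k
      using norm_pow_mat_le[OF M B ij, of k] by (simp add: norm_divide divide_simps)
  qed
qed

definition transition_mat :: "nat pair_pre_digraph \<Rightarrow> real \<Rightarrow> complex mat" where
  "transition_mat G t = mat_exp ((- \<i> * complex_of_real t) \<cdot>\<^sub>m adj_mat G)"

text \<open>The type of vectors carries no topology, so limits of vectors are taken entrywise.\<close>

definition vec_tendsto :: "(nat \<Rightarrow> complex vec) \<Rightarrow> complex vec \<Rightarrow> bool" where
  "vec_tendsto X L \<longleftrightarrow> (\<forall>k. dim_vec (X k) = dim_vec L) \<and>
     (\<forall>i < dim_vec L. (\<lambda>k. X k $ i) \<longlonglongrightarrow> L $ i)"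

definition pgfr_from_to :: "nat pair_pre_digraph \<Rightarrow> nat \<Rightarrow> nat \<Rightarrow> bool" where
  "pgfr_from_to G a b \<longleftrightarrow> a \<in> pverts G \<and> b \<in> pverts G \<and> b \<noteq> a \<and>
     (\<exists>(t :: nat \<Rightarrow> real) (\<alpha> :: complex) (\<beta> :: complex).
        \<beta> \<noteq> 0 \<and> (cmod \<alpha>)\<^sup>2 + (cmod \<beta>)\<^sup>2 = 1 \<and>
        vec_tendsto (\<lambda>k. transition_mat G (t k) *\<^sub>v unit_vec (card (pverts G)) a)
          (\<alpha> \<cdot>\<^sub>v unit_vec (card (pverts G)) a + \<beta> \<cdot>\<^sub>v unit_vec (card (pverts G)) b))"

definition admits_pgfr :: "nat pair_pre_digraph \<Rightarrow> bool" where
  "admits_pgfr G \<longleftrightarrow> (\<exists>a b. pgfr_from_to G a b)"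

end

(*
  The characters of the integers mod n are eigenvectors of the adjacency matrix, with the Ramanujan
  sums c(j) as eigenvalues. Revival from a to b along t_k therefore means that exp(-i t_k c(j)) tends
  to alpha + beta w^(j(b-a)) for all j, where w = exp(2 pi i/n). As c(-j) = c(j), the limits
  for j = 1 and j = -1 agree, so n is even and b - a = n/2: the limit depends only on the parity of j,
  and beta vanishes iff the even limit g equals the odd limit d.

  To see that g = d unless n/2 is 1 or a prime, use c(j) = 0 whenever some translation by s preserves
  the units and w^(js) is not 1, c(j + n/2) = -c(j), and c(pj) = -(p-1) c(j) for a prime p dividing
  n exactly once but not dividing j. The last identity gives x^p = 1 for x = g or x = d. Either
  c(1) = c(2) = 0, or 4 divides n, d = 1, and g is 1 or satisfies g^2 = g^p = 1 with p odd; or n/2 is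
  odd, d^p = d^q = 1 for distinct primes p, q, and g d = 1.

  Conversely exact revival occurs at t = pi/2 for n = 2, 4, and at t = 2 pi/p for n = 2p with p odd,
  where the eigenvalues are (-1)^j (p-1) if p divides j and -(-1)^j otherwise.
*)

theory Submission
  imports Defs "HOL-Number_Theory.Totient"
begin

section \<open>Additive characters modulo n, their orthogonality and Fourier inversion\<close>

definition root_char :: "nat \<Rightarrow> int \<Rightarrow> complex" where
  "root_char n k = cis (2 * pi * of_int k / of_nat n)"

lemma root_char_0 [simp]: "root_char n 0 = 1"
  by (simp add: root_char_def)

lemma root_char_add: "root_char n (j + k) = root_char n j * root_char n k"
  by (simp add: root_char_def cis_mult ring_distribs add_divide_distrib)

lemma root_char_eq_1_iff:
  assumes "n > 0"
  shows "root_char n k = 1 \<longleftrightarrow> int n dvd k"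
proof
  assume "root_char n k = 1"
  then have "cos (2 * pi * of_int k / of_nat n) = 1"
    by (simp add: root_char_def complex_eq_iff)
  then obtain m where "2 * pi * of_int k / of_nat n = of_int m * 2 * pi"
    using cos_one_2pi_int by auto
  then have "(of_int k :: real) = of_int (m * int n)"
    using assms by (simp add: field_simps)
  then have "k = m * int n" by (simp only: of_int_eq_iff)
  then show "int n dvd k" by simp
next
  assume "int n dvd k"
  then obtain m where "k = int n * m" by auto
  then have "2 * pi * of_int k / of_nat n = 2 * pi * of_int m"
    using assms by simp
  then show "root_char n k = 1"
    by (simp add: root_char_def cis_multiple_2pi)
qed

lemma root_char_mod:
  assumes "n > 0"
  shows "root_char n (k mod int n) = root_char n k"
proof -
  have "root_char n k = root_char n (k mod int n + int n * (k div int n))" by simp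
  also have "\<dots> = root_char n (k mod int n)"
    unfolding root_char_add using root_char_eq_1_iff[OF assms, of "int n * (k div int n)"] by simp
  finally show ?thesis by simp
qed

lemma root_char_cong:
  assumes "n > 0" "[j = k] (mod int n)"
  shows "root_char n j = root_char n k"
  using assms root_char_mod unfolding cong_def by metis

lemma root_char_mult_mod:
  assumes "n > 0"
  shows "root_char n (j * (x mod int n)) = root_char n (j * x)"
  by (rule root_char_cong[OF assms]) (simp add: cong_def mod_mult_right_eq)

lemma root_char_mult_cancel:
  assumes "p > 0"
  shows "root_char (p * m) (int p * k) = root_char m k"
  using assms by (simp add: root_char_def mult.assoc)

text \<open>An injective self-map of a finite set is a bijection, so the residues of
  \<open>h x\<close> form a complete system. It serves translations and multiplication by units
  alike.\<close>

lemma sum_residues_reindex: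
  fixes f :: "int \<Rightarrow> 'a::comm_monoid_add" and h :: "nat \<Rightarrow> int"
  assumes "n > 0"
    and per: "\<And>x. f (x mod int n) = f x"
    and inj: "\<And>x y. x < n \<Longrightarrow> y < n \<Longrightarrow> [h x = h y] (mod int n) \<Longrightarrow> x = y"
  shows "(\<Sum>x<n. f (h x)) = (\<Sum>x<n. f (int x))"
proof -
  define g where "g x = nat (h x mod int n)" for x
  have g: "int (g x) = h x mod int n" for x
    using assms(1) by (simp add: g_def)
  have "inj_on g {..<n}"
    using inj g by (auto simp: inj_on_def cong_def) metis
  moreover have "g ` {..<n} \<subseteq> {..<n}"
    using assms(1) by (auto simp: g_def nat_less_iff)
  ultimately have "g ` {..<n} = {..<n}"
    by (simp add: endo_inj_surj)
  with \<open>inj_on g {..<n}\<close> have "(\<Sum>x<n. f (int x)) = (\<Sum>x<n. f (int (g x)))"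
    using sum.reindex[of g "{..<n}" "\<lambda>x. f (int x)"] by simp
  then show ?thesis by (simp add: g per)
qed

lemma sum_residues_shift:
  fixes f :: "int \<Rightarrow> 'a::comm_monoid_add"
  assumes "n > 0" "\<And>x. f (x mod int n) = f x"
  shows "(\<Sum>x<n. f (int x + c)) = (\<Sum>x<n. f (int x))"
  by (rule sum_residues_reindex)
    (use assms in \<open>auto simp: cong_add_rcancel cong_int_iff dest: cong_less_modulus_unique_nat\<close>)

text \<open>Orthogonality of characters: shifting j by one multiplies the sum by w^c, so the sum
  vanishes unless w^c = 1.\<close>

lemma sum_root_char:
  assumes "n > 0"
  shows "(\<Sum>j<n. root_char n (int j * c)) = (if int n dvd c then of_nat n else 0)"
proof (cases "int n dvd c")
  case True
  then have "root_char n (int j * c) = 1" for j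
    using assms by (simp add: root_char_eq_1_iff)
  then show ?thesis using True by simp
next
  case False
  let ?S = "\<Sum>j<n. root_char n (int j * c)"
  have "?S = (\<Sum>j<n. root_char n ((int j + 1) * c))"
    by (rule sum_residues_shift[symmetric, where f = "\<lambda>x. root_char n (x * c)"])
      (use assms in \<open>auto intro!: root_char_cong simp: cong_def mod_mult_left_eq\<close>)
  also have "\<dots> = root_char n c * ?S"
    by (simp add: ring_distribs root_char_add sum_distrib_left mult.commute)
  finally have "?S = 0"
    using root_char_eq_1_iff[OF assms, of c] False by auto
  then show ?thesis using False by simp
qed

text \<open>Fourier inversion. It allows the entries of a column of the transition matrix to be
  identified from its eigenvalues alone.\<close>

lemma dft_inject:
  assumes "n > 0" "l < n"
    and "\<And>j. j < n \<Longrightarrow> (\<Sum>i<n. root_char n (int j * int i) * v i)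
                     = (\<Sum>i<n. root_char n (int j * int i) * w i)"
  shows "v l = w l"
proof -
  have inv: "(\<Sum>j<n. root_char n (- (int j * int l)) * (\<Sum>i<n. root_char n (int j * int i) * u i))
      = of_nat n * u l" for u
  proof -
    have "(\<Sum>j<n. root_char n (- (int j * int l)) * (\<Sum>i<n. root_char n (int j * int i) * u i))
        = (\<Sum>j<n. \<Sum>i<n. root_char n (int j * (int i - int l)) * u i)"
      by (simp add: sum_distrib_left algebra_simps flip: root_char_add)
    also have "\<dots> = (\<Sum>i<n. (\<Sum>j<n. root_char n (int j * (int i - int l))) * u i)"
      by (subst sum.swap) (simp add: sum_distrib_right)
    also have "\<dots> = (\<Sum>i<n. (if i = l then of_nat n * u i else 0))"
    proof (rule sum.cong)
      fix i assume "i \<in> {..<n}"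
      then have "int n dvd int i - int l \<longleftrightarrow> i = l"
        using assms(2) by (metis cong_iff_dvd_diff cong_int_iff cong_less_modulus_unique_nat
            cong_refl lessThan_iff)
      then show "(\<Sum>j<n. root_char n (int j * (int i - int l))) * u i
          = (if i = l then of_nat n * u i else 0)"
        using sum_root_char[OF assms(1)] by auto
    qed simp
    finally show ?thesis using assms(2) by simp
  qed
  have "of_nat n * v l = of_nat n * w l"
    unfolding inv[symmetric] using assms(3) by simp
  then show ?thesis using assms(1) by simp
qed

section \<open>Ramanujan sums\<close>

text \<open>For n = 1 the value is 1, as 0 is coprime to 1, although X_1 has no arcs; the spectral
  results therefore assume n > 1.\<close>

definition ramanujan_sum :: "nat \<Rightarrow> int \<Rightarrow> complex" where
  "ramanujan_sum n j = (\<Sum>x<n. if coprime (int x) (int n) then root_char n (j * int x) else 0)"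

lemma coprime_mod_int: "coprime (x mod int n) (int n) \<longleftrightarrow> coprime x (int n)"
  by (metis coprime_iff_gcd_eq_1 gcd.commute gcd_red_int)

text \<open>With c = -l this evaluates the adjacency sum at vertex l; with c a translation that
  preserves the units it yields the vanishing of \<open>ramanujan_sum\<close>.\<close>

lemma sum_units_root_char_shift:
  assumes "n > 0"
  shows "(\<Sum>x<n. if coprime (int x + c) (int n) then root_char n (j * (int x + c)) else 0)
       = ramanujan_sum n j"
  unfolding ramanujan_sum_def
  by (rule sum_residues_shift[OF assms, where f =
        "\<lambda>x. if coprime x (int n) then root_char n (j * x) else 0"])
    (use assms in \<open>simp_all add: coprime_mod_int root_char_mult_mod\<close>)

text \<open>Multiplication by the unit c permutes the units modulo n.\<close>

lemma ramanujan_sum_scale: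
  assumes "n > 0" "coprime c (int n)"
  shows "ramanujan_sum n (j * c) = ramanujan_sum n j"
proof -
  have "(\<Sum>x<n. if coprime (c * int x) (int n) then root_char n (j * (c * int x)) else 0)
       = ramanujan_sum n j"
    unfolding ramanujan_sum_def
  proof (rule sum_residues_reindex[where f = "\<lambda>x. if coprime x (int n) then root_char n (j * x) else 0"])
    show "x = y" if "x < n" "y < n" "[c * int x = c * int y] (mod int n)" for x y
      using that assms cong_mult_lcancel[of c "int n" "int x" "int y"]
      by (auto simp: cong_int_iff dest: cong_less_modulus_unique_nat)
  qed (use assms in \<open>simp_all add: coprime_mod_int root_char_mult_mod\<close>)
  then show ?thesis
    using assms(2) by (simp add: ramanujan_sum_def mult.assoc cong: if_cong)
qed

lemma ramanujan_sum_minus: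
  assumes "n > 0"
  shows "ramanujan_sum n (- j) = ramanujan_sum n j"
  using ramanujan_sum_scale[OF assms, of "-1" j] by simp

lemma ramanujan_sum_cong:
  assumes "n > 0" "[j = k] (mod int n)"
  shows "ramanujan_sum n j = ramanujan_sum n k"
  unfolding ramanujan_sum_def
  by (intro sum.cong refl if_cong root_char_cong[OF assms(1)]) (rule cong_mult[OF assms(2)], simp)

text \<open>The divisibility assumptions ensure that \<open>d\<close> and \<open>n\<close> have the same prime divisors, so that
  translation by \<open>d\<close> permutes the units modulo \<open>n\<close>.\<close>

lemma ramanujan_sum_eq_0:
  assumes "n > 0" "d dvd int n" "int n dvd d ^ 3" "\<not> int n dvd j * d"
  shows "ramanujan_sum n j = 0"
proof -
  have cop: "coprime x (int n) \<longleftrightarrow> coprime x d" for x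
  proof
    assume "coprime x d"
    \<comment> \<open>Any power of d divisible by n would do; n = 8 with d = 2 already needs the
      third.\<close>
    then have "coprime x (d ^ 3)" by simp
    then show "coprime x (int n)" by (rule coprime_divisors[OF dvd_refl assms(3)])
  qed (rule coprime_divisors[OF dvd_refl assms(2)])
  have "ramanujan_sum n j
      = (\<Sum>x<n. if coprime (int x + d) (int n) then root_char n (j * (int x + d)) else 0)"
    using sum_units_root_char_shift[OF assms(1)] by simp
  \<comment> \<open>The sum reproduces itself with the factor w^(jd), which is not 1.\<close>
  also have "\<dots> = root_char n (j * d) * ramanujan_sum n j"
    unfolding ramanujan_sum_def cop sum_distrib_left
    by (intro sum.cong) (auto simp: ring_distribs root_char_add mult.commute coprime_iff_gcd_eq_1)
  finally show ?thesis
    using root_char_eq_1_iff[OF assms(1), of "j * d"] assms(4) by auto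
qed

lemma sum_periodic_blocks:
  fixes f :: "int \<Rightarrow> complex"
  assumes "\<And>x. f (x mod int m) = f x"
  shows "(\<Sum>x<p * m. f (int x)) = of_nat p * (\<Sum>x<m. f (int x))"
proof -
  have "(\<Sum>x<p * m. f (int x)) = (\<Sum>q<p. \<Sum>x=q * m..<q * m + m. f (int x))"
    by (rule sum.nat_group[symmetric])
  also have "\<dots> = (\<Sum>q<p. \<Sum>x<m. f (int x))"
  proof (rule sum.cong)
    fix q
    have "(\<Sum>x=q * m..<q * m + m. f (int x)) = (\<Sum>x=0..<m. f (int (x + q * m)))"
      using sum.shift_bounds_nat_ivl[of "\<lambda>x. f (int x)" 0 "q * m" m] by (simp add: add.commute)
    also have "\<dots> = (\<Sum>x<m. f (int x))"
    proof (intro sum.cong)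
      fix x
      have "f (int (x + q * m) mod int m) = f (int x mod int m)" by simp
      then show "f (int (x + q * m)) = f (int x)" unfolding assms .
    qed auto
    finally show "(\<Sum>x=q * m..<q * m + m. f (int x)) = (\<Sum>x<m. f (int x))" .
  qed simp
  finally show ?thesis by simp
qed

text \<open>Both sides are multiples of the Ramanujan sum modulo \<open>m\<close>: write the sum over the units
  modulo \<open>p * m\<close> as the sum over all residues prime to \<open>m\<close>, minus that over the multiples of \<open>p\<close>
  among them.\<close>

lemma ramanujan_sum_prime_mult:
  assumes p: "prime p" and "m > 0" and cop: "coprime p m" and j: "\<not> int p dvd j"
  shows "ramanujan_sum (p * m) (int p * j) = - of_nat (p - 1) * ramanujan_sum (p * m) j"
proof -
  define n where "n = p * m"
  have "p > 0" using p prime_gt_0_nat by blast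
  then have n: "n > 0" using \<open>m > 0\<close> by (simp add: n_def)
  define T where "T k = (\<Sum>x<n. if coprime (int x) (int m) then root_char n (k * int x) else 0)" for k
  have split: "ramanujan_sum n k = T k - ramanujan_sum m k" for k
  proof -
    have "coprime x p \<longleftrightarrow> \<not> p dvd x" for x
      using p by (metis coprime_absorb_right coprime_commute not_prime_unit prime_imp_coprime)
    then have unit: "coprime (int x) (int n) \<longleftrightarrow> coprime (int x) (int m) \<and> \<not> p dvd x" for x
      by (simp add: n_def conj_commute)
    have "T k - ramanujan_sum n k
        = (\<Sum>x<n. if p dvd x then (if coprime (int x) (int m) then root_char n (k * int x) else 0) else 0)"
      unfolding T_def ramanujan_sum_def sum_subtractf[symmetric] unit by (intro sum.cong) auto
    also have "\<dots> = (\<Sum>x \<in> {x. x < n \<and> p dvd x}.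
        if coprime (int x) (int m) then root_char n (k * int x) else 0)"
      by (simp add: sum.If_cases Int_def)
    \<comment> \<open>Multiples of p are written as p y; the factor p drops out of the coprimality
      condition and turns the character modulo p m into one modulo m.\<close>
    also have "\<dots> = (\<Sum>y<m. if coprime (int (p * y)) (int m) then root_char n (k * int (p * y)) else 0)"
      by (rule sum.reindex_bij_witness[of _ "\<lambda>y. p * y" "\<lambda>x. x div p"])
        (use \<open>p > 0\<close> in \<open>auto simp: n_def less_mult_imp_div_less mult.commute\<close>)
    also have "\<dots> = ramanujan_sum m k"
      unfolding ramanujan_sum_def
      using cop \<open>p > 0\<close> by (intro sum.cong) (auto simp: n_def root_char_mult_cancel mult.left_commute[of k])
    finally show ?thesis by (simp add: algebra_simps)
  qed
  \<comment> \<open>Translation by m preserves coprimality to m and multiplies the sum by w^(jm),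
    which differs from 1 because p does not divide j.\<close>
  have "T j = 0"
  proof -
    have cop_mod: "coprime (x mod int n) (int m) \<longleftrightarrow> coprime x (int m)" for x
    proof -
      have "x mod int n mod int m = x mod int m" by (simp add: n_def mod_mod_cancel)
      then show ?thesis by (metis coprime_mod_int)
    qed
    have "T j = (\<Sum>x<n. if coprime (int x + int m) (int m) then root_char n (j * (int x + int m)) else 0)"
      unfolding T_def
      by (rule sum_residues_shift[OF n, symmetric, where f =
            "\<lambda>x. if coprime x (int m) then root_char n (j * x) else 0"])
        (simp add: cop_mod root_char_mult_mod[OF n])
    also have "\<dots> = root_char n (j * int m) * T j"
      unfolding T_def sum_distrib_left
    proof (rule sum.cong)
      fix x
      have "coprime (int x + int m) (int m) \<longleftrightarrow> coprime (int x) (int m)"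
        by (metis coprime_iff_gcd_eq_1 gcd_add1)
      then show "(if coprime (int x + int m) (int m) then root_char n (j * (int x + int m)) else 0)
          = root_char n (j * int m) * (if coprime (int x) (int m) then root_char n (j * int x) else 0)"
        by (simp only: ring_distribs root_char_add) simp
    qed simp
    finally show ?thesis
      using root_char_eq_1_iff[OF n, of "j * int m"] j \<open>m > 0\<close> by (auto simp: n_def)
  qed
  \<comment> \<open>Here the summand depends on x modulo m only, so the sum covers p full
    periods.\<close>
  moreover have "T (int p * j) = of_nat p * ramanujan_sum m j"
  proof -
    have "T (int p * j)
        = (\<Sum>x<p * m. if coprime (int x) (int m) then root_char m (j * int x) else 0)"
      unfolding T_def n_def using \<open>p > 0\<close> by (simp add: mult.assoc root_char_mult_cancel cong: if_cong)
    also have "\<dots> = of_nat p * ramanujan_sum m j"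
      unfolding ramanujan_sum_def
      by (rule sum_periodic_blocks[where f =
            "\<lambda>x. if coprime x (int m) then root_char m (j * x) else 0"])
        (simp add: coprime_mod_int root_char_mult_mod[OF \<open>m > 0\<close>])
    finally show ?thesis .
  qed
  moreover have "ramanujan_sum m (int p * j) = ramanujan_sum m j"
    using ramanujan_sum_scale[OF \<open>m > 0\<close>, of "int p" j] cop by (simp add: mult.commute)
  \<comment> \<open>With r the Ramanujan sum modulo m at j, the left-hand sum is p r - r, while that
    at j is -r.\<close>
  ultimately show ?thesis
    using split[of j] split[of "int p * j"] \<open>p > 0\<close> by (simp add: n_def of_nat_diff algebra_simps)
qed

lemma ramanujan_sum_0:
  assumes "n > 1"
  shows "ramanujan_sum n 0 = of_nat (totient n)"
proof -
  \<comment> \<open>\<open>totatives\<close> ranges over 1..n instead of 0..n-1; for n > 1 neither 0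
    nor n is coprime to n.\<close>
  have "{x. x < n \<and> coprime x n} = totatives n"
    using assms by (auto simp: totatives_def le_less intro!: Nat.gr0I)
  then show ?thesis
    by (simp add: ramanujan_sum_def totient_def sum.If_cases Int_def)
qed

text \<open>Units modulo an even n are odd, and w^m = -1, so every summand changes sign.\<close>

lemma ramanujan_sum_add_half:
  assumes "n = 2 * m" "n > 0"
  shows "ramanujan_sum n (j + int m) = - ramanujan_sum n j"
proof -
  have "root_char n ((j + int m) * int x) = - root_char n (j * int x)" if "coprime (int x) (int n)" for x
  proof -
    have "odd x"
      using that assms(1) by auto
    then obtain y where "x = 2 * y + 1" by (elim oddE)
    then have "int m * int x = int n * int y + int m" using assms(1) by (simp add: algebra_simps)
    moreover have "root_char n (int m) = -1"
      using assms by (simp add: root_char_def)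
    ultimately have "root_char n (int m * int x) = -1"
      using root_char_eq_1_iff[OF assms(2), of "int n * int y"] by (simp add: root_char_add)
    then show ?thesis by (simp add: ring_distribs root_char_add)
  qed
  then show ?thesis
    unfolding ramanujan_sum_def sum_negf[symmetric] by (intro sum.cong) auto
qed

section \<open>The spectrum of the transition matrix\<close>

text \<open>A left eigenvector of M is one of every power of M, and the exponential series is summed
  entrywise. Left eigenvectors are used because revival concerns a column of the transition matrix,
  to be paired with characters.\<close>

lemma mat_exp_left_eigenvector:
  fixes M :: "complex mat"
  assumes M: "M \<in> carrier_mat n n"
    and eig: "\<And>l. l < n \<Longrightarrow> (\<Sum>i<n. v i * M $$ (i, l)) = \<mu> * v l"
    and l: "l < n"
  shows "(\<Sum>i<n. v i * mat_exp M $$ (i, l)) = exp \<mu> * v l"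
proof -
  have pow: "(\<Sum>i<n. v i * (M ^\<^sub>m k) $$ (i, l)) = \<mu> ^ k * v l" if "l < n" for k l
    using that
  proof (induction k arbitrary: l)
    case 0
    have "(\<Sum>i<n. v i * (M ^\<^sub>m 0) $$ (i, l)) = (\<Sum>i<n. if i = l then v i else 0)"
      using M 0 by (intro sum.cong) auto
    then show ?case using 0 by simp
  next
    case (Suc k)
    have "(\<Sum>i<n. v i * (M ^\<^sub>m Suc k) $$ (i, l))
        = (\<Sum>i<n. \<Sum>r<n. v i * (M ^\<^sub>m k) $$ (i, r) * M $$ (r, l))"
      using M Suc.prems
      by (simp add: scalar_prod_def pow_mat_dim sum_distrib_left mult.assoc atLeast0LessThan)
    also have "\<dots> = (\<Sum>r<n. (\<Sum>i<n. v i * (M ^\<^sub>m k) $$ (i, r)) * M $$ (r, l))"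
      by (subst sum.swap) (simp add: sum_distrib_right)
    also have "\<dots> = \<mu> ^ k * (\<Sum>r<n. v r * M $$ (r, l))"
      using Suc.IH by (simp add: sum_distrib_left mult.assoc)
    finally show ?case using eig[OF Suc.prems] by simp
  qed
  have "(\<lambda>k. v i * ((M ^\<^sub>m k) $$ (i, l) / fact k)) sums (v i * mat_exp M $$ (i, l))" if "i < n" for i
  proof -
    have "summable (\<lambda>k. (M ^\<^sub>m k) $$ (i, l) / fact k)"
      using summable_mat_exp[OF M that l] by (rule summable_norm_cancel)
    then show ?thesis
      using M that l by (intro sums_mult) (simp add: mat_exp_def summable_sums)
  qed
  then have "(\<lambda>k. \<Sum>i<n. v i * ((M ^\<^sub>m k) $$ (i, l) / fact k)) sums (\<Sum>i<n. v i * mat_exp M $$ (i, l))"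
    by (intro sums_sum) auto
  moreover have "(\<Sum>i<n. v i * ((M ^\<^sub>m k) $$ (i, l) / fact k)) = \<mu> ^ k /\<^sub>R fact k * v l" for k
    using pow[OF l, of k] by (simp add: sum_divide_distrib[symmetric] scaleR_conv_of_real field_simps)
  ultimately have "(\<lambda>k. \<mu> ^ k /\<^sub>R fact k * v l) sums (\<Sum>i<n. v i * mat_exp M $$ (i, l))"
    by (simp only:)
  then show ?thesis
    using sums_mult2[OF exp_converges] by (rule sums_unique2)
qed

lemma unitary_cayley_arc_iff:
  assumes "n > 1" "a < n" "b < n"
  shows "(a, b) \<in> parcs (unitary_cayley n) \<longleftrightarrow> coprime (int a - int b) (int n)"
proof
  assume "(a, b) \<in> parcs (unitary_cayley n)"
  then have "\<exists>u. coprime u (int n) \<and> [int a - int b = u] (mod int n)"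
    by (auto simp: unitary_cayley_def coprime_iff_gcd_eq_1)
  then show "coprime (int a - int b) (int n)"
    using cong_imp_coprime cong_sym by blast
next
  assume cop: "coprime (int a - int b) (int n)"
  define u where "u = (int a - int b) mod int n"
  have gcd: "gcd u (int n) = 1"
    using cop by (simp only: u_def coprime_mod_int flip: coprime_iff_gcd_eq_1)
  \<comment> \<open>Residue 0 would have gcd n > 1 with n.\<close>
  have "u \<noteq> 0" using gcd assms(1) by auto
  moreover have "0 \<le> u" "u < int n" using assms(1) by (auto simp: u_def)
  ultimately have "1 \<le> u" "u \<le> int n - 1" by auto
  moreover have "a \<noteq> b" using \<open>u \<noteq> 0\<close> by (auto simp: u_def)
  moreover have "[int a - int b = u] (mod int n)" by (simp add: u_def cong_def)
  ultimately show "(a, b) \<in> parcs (unitary_cayley n)"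
    using gcd assms by (auto simp: unitary_cayley_def)
qed

lemma transition_mat_carrier:
  "transition_mat (unitary_cayley n) t \<in> carrier_mat n n"
  by (simp add: transition_mat_def mat_exp_def adj_mat_def unitary_cayley_def)

text \<open>Factoring w^(jl) out of the sum over the neighbours of l leaves w^(j(i-l)) summed over
  the units i - l.\<close>

lemma transition_mat_eigenvector:
  assumes n: "n > 1" and l: "l < n"
  shows "(\<Sum>i<n. root_char n (j * int i) * transition_mat (unitary_cayley n) t $$ (i, l))
       = exp (- \<i> * of_real t * ramanujan_sum n j) * root_char n (j * int l)"
  unfolding transition_mat_def
proof (rule mat_exp_left_eigenvector[OF _ _ l])
  have dim: "card (pverts (unitary_cayley n)) = n" by (simp add: unitary_cayley_def)
  show "(- \<i> * of_real t) \<cdot>\<^sub>m adj_mat (unitary_cayley n) \<in> carrier_mat n n"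
    by (simp add: adj_mat_def dim)
  fix l assume l: "l < n"
  have "(\<Sum>i<n. root_char n (j * int i) * ((- \<i> * of_real t) \<cdot>\<^sub>m adj_mat (unitary_cayley n)) $$ (i, l))
     = (\<Sum>i<n. (- \<i> * of_real t) * root_char n (j * int l) *
         (if coprime (int i + - int l) (int n) then root_char n (j * (int i + - int l)) else 0))"
    using l by (intro sum.cong)
      (auto simp: adj_mat_def dim unitary_cayley_arc_iff[OF n] algebra_simps simp flip: root_char_add)
  also have "\<dots> = - \<i> * of_real t * root_char n (j * int l) * ramanujan_sum n j"
    using n by (simp only: sum_units_root_char_shift flip: sum_distrib_left)
  finally show "(\<Sum>i<n. root_char n (j * int i) *
      ((- \<i> * of_real t) \<cdot>\<^sub>m adj_mat (unitary_cayley n)) $$ (i, l))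
     = - \<i> * of_real t * ramanujan_sum n j * root_char n (j * int l)"
    by (simp add: mult_ac)
qed

section \<open>Fractional revival\<close>

lemma pgfr_unitary_cayley_iff_entries:
  "pgfr_from_to (unitary_cayley n) a b \<longleftrightarrow> a < n \<and> b < n \<and> b \<noteq> a \<and>
     (\<exists>t \<alpha> \<beta>. \<beta> \<noteq> 0 \<and> (cmod \<alpha>)\<^sup>2 + (cmod \<beta>)\<^sup>2 = 1 \<and>
       (\<forall>i<n. (\<lambda>k. transition_mat (unitary_cayley n) (t k) $$ (i, a)) \<longlonglongrightarrow>
         (if i = a then \<alpha> else 0) + (if i = b then \<beta> else 0)))"
proof -
  let ?H = "transition_mat (unitary_cayley n)"
  have vert: "pverts (unitary_cayley n) = {0..<n}" by (simp add: unitary_cayley_def)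
  have "vec_tendsto (\<lambda>k. ?H (t k) *\<^sub>v unit_vec n a) (\<alpha> \<cdot>\<^sub>v unit_vec n a + \<beta> \<cdot>\<^sub>v unit_vec n b) \<longleftrightarrow>
      (\<forall>i<n. (\<lambda>k. ?H (t k) $$ (i, a)) \<longlonglongrightarrow> (if i = a then \<alpha> else 0) + (if i = b then \<beta> else 0))"
    if "a < n" "b < n" for t :: "nat \<Rightarrow> real" and \<alpha> \<beta>
  proof -
    have H: "?H s \<in> carrier_mat n n" for s by (rule transition_mat_carrier)
    have "(?H s *\<^sub>v unit_vec n a) $ i = ?H s $$ (i, a)" if "i < n" for s i
      using H[of s] \<open>a < n\<close> that by (simp add: row_def)
    moreover have "(\<alpha> \<cdot>\<^sub>v unit_vec n a + \<beta> \<cdot>\<^sub>v unit_vec n b) $ i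
        = (if i = a then \<alpha> else 0) + (if i = b then \<beta> else 0)" if "i < n" for i
      using that \<open>a < n\<close> \<open>b < n\<close> by simp
    ultimately show ?thesis
      using carrier_matD[OF H] by (simp add: vec_tendsto_def)
  qed
  then show ?thesis
    unfolding pgfr_from_to_def vert by (simp split del: if_split cong: conj_cong)
qed

text \<open>The limit of column a is paired with the j-th character, which turns the column into a
  phase times w^(ja); that factor is then divided out.\<close>

lemma pgfr_phase_limit:
  assumes n: "n > 1" and pgfr: "pgfr_from_to (unitary_cayley n) a b"
  shows "\<exists>t \<alpha> \<beta>. \<beta> \<noteq> 0 \<and>
    (\<forall>j. (\<lambda>k. exp (- \<i> * of_real (t k) * ramanujan_sum n j))
            \<longlonglongrightarrow> \<alpha> + \<beta> * root_char n (j * (int b - int a)))"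
proof -
  let ?H = "transition_mat (unitary_cayley n)"
  from pgfr obtain t \<alpha> \<beta> where ab: "a < n" "b < n" "b \<noteq> a" and "\<beta> \<noteq> 0"
    and lim: "\<And>i. i < n \<Longrightarrow> (\<lambda>k. ?H (t k) $$ (i, a)) \<longlonglongrightarrow>
         (if i = a then \<alpha> else 0) + (if i = b then \<beta> else 0)"
    unfolding pgfr_unitary_cayley_iff_entries by blast
  have "(\<lambda>k. exp (- \<i> * of_real (t k) * ramanujan_sum n j))
            \<longlonglongrightarrow> \<alpha> + \<beta> * root_char n (j * (int b - int a))" for j
  proof -
    let ?e = "\<lambda>i. root_char n (j * int i)"
    have "(\<lambda>k. \<Sum>i<n. ?e i * ?H (t k) $$ (i, a)) \<longlonglongrightarrow>
        (\<Sum>i<n. ?e i * ((if i = a then \<alpha> else 0) + (if i = b then \<beta> else 0)))"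
      by (intro tendsto_sum tendsto_mult tendsto_const lim) auto
    also have "(\<Sum>i<n. ?e i * ((if i = a then \<alpha> else 0) + (if i = b then \<beta> else 0)))
        = (\<Sum>i<n. (if i = a then \<alpha> * ?e i else 0) + (if i = b then \<beta> * ?e i else 0))"
      by (intro sum.cong) (auto simp: algebra_simps)
    also have "\<dots> = \<alpha> * ?e a + \<beta> * ?e b"
      using ab by (simp add: sum.distrib)
    finally have "(\<lambda>k. exp (- \<i> * of_real (t k) * ramanujan_sum n j) * ?e a)
        \<longlonglongrightarrow> \<alpha> * ?e a + \<beta> * ?e b"
      by (simp add: transition_mat_eigenvector[OF n ab(1)])
    then have "(\<lambda>k. exp (- \<i> * of_real (t k) * ramanujan_sum n j) * ?e a * root_char n (- (j * int a)))
        \<longlonglongrightarrow> (\<alpha> * ?e a + \<beta> * ?e b) * root_char n (- (j * int a))"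
      by (intro tendsto_mult tendsto_const)
    moreover have "?e a * root_char n (- (j * int a)) = 1"
      "?e b * root_char n (- (j * int a)) = root_char n (j * (int b - int a))"
      by (simp_all add: right_diff_distrib flip: root_char_add)
    ultimately show ?thesis by (simp add: distrib_right mult.assoc)
  qed
  with \<open>\<beta> \<noteq> 0\<close> show ?thesis by blast
qed

lemma root_char_half:
  assumes "n = 2 * m" "m > 0"
  shows "root_char n (j * int m) = (if even j then 1 else -1)"
proof -
  have "root_char n (int n * k) = 1" for k
    using assms root_char_eq_1_iff[of n] by simp
  moreover have "root_char n (int m) = -1"
    using assms by (simp add: root_char_def)
  moreover have "j * int m = int n * (j div 2) + (if even j then 0 else int m)"
    using assms by (auto elim!: evenE oddE simp: algebra_simps)
  ultimately show ?thesis by (simp add: root_char_add)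
qed

text \<open>The spectral condition forces \<open>\<alpha> = (\<gamma> + \<delta>) / 2\<close> and \<open>\<beta> = (\<gamma> - \<delta>) / 2\<close>.\<close>

lemma pgfr_antipodal:
  assumes n: "n = 2 * m" "m > 0"
    and phase: "\<And>j. exp (- \<i> * of_real t * ramanujan_sum n j) = (if even j then \<gamma> else \<delta>)"
    and norm: "cmod \<gamma> = 1" "cmod \<delta> = 1" and neq: "\<gamma> \<noteq> \<delta>"
  shows "pgfr_from_to (unitary_cayley n) 0 m"
proof -
  define \<alpha> \<beta> where "\<alpha> = (\<gamma> + \<delta>) / 2" and "\<beta> = (\<gamma> - \<delta>) / 2"
  let ?H = "transition_mat (unitary_cayley n) t"
  have n1: "n > 1" using n by simp
  \<comment> \<open>Parallelogram law: the squared moduli of half the sum and half the difference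
    add up to the mean of those of \<gamma> and \<delta>.\<close>
  have "(Re \<gamma>)\<^sup>2 + (Im \<gamma>)\<^sup>2 = 1" "(Re \<delta>)\<^sup>2 + (Im \<delta>)\<^sup>2 = 1"
    using norm by (simp_all flip: cmod_power2)
  then have one: "(cmod \<alpha>)\<^sup>2 + (cmod \<beta>)\<^sup>2 = 1"
    unfolding cmod_power2 by (simp add: \<alpha>_def \<beta>_def power2_eq_square field_simps)
  have "?H $$ (i, 0) = (if i = 0 then \<alpha> else 0) + (if i = m then \<beta> else 0)" if "i < n" for i
  proof (rule dft_inject[OF _ that, where v = "\<lambda>i. ?H $$ (i, 0)"])
    fix j
    have "(\<Sum>i<n. root_char n (int j * int i) * ((if i = 0 then \<alpha> else 0) + (if i = m then \<beta> else 0)))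
        = (\<Sum>i<n. (if i = 0 then \<alpha> * root_char n (int j * int i) else 0)
             + (if i = m then \<beta> * root_char n (int j * int i) else 0))"
      by (intro sum.cong) (auto simp: algebra_simps)
    also have "\<dots> = \<alpha> + \<beta> * root_char n (int j * int m)"
      using n by (simp add: sum.distrib)
    also have "\<dots> = (if even j then \<gamma> else \<delta>)"
      by (simp add: root_char_half[OF n] \<alpha>_def \<beta>_def field_simps)
    also have "\<dots> = (\<Sum>i<n. root_char n (int j * int i) * ?H $$ (i, 0))"
      using transition_mat_eigenvector[OF n1, of 0 "int j" t] phase[of "int j"] n by simp
    finally show "(\<Sum>i<n. root_char n (int j * int i) * ?H $$ (i, 0))
      = (\<Sum>i<n. root_char n (int j * int i) * ((if i = 0 then \<alpha> else 0) + (if i = m then \<beta> else 0)))" ..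
  qed (use n in simp)
  \<comment> \<open>Revival is exact at time t, so a constant sequence of times suffices.\<close>
  then show ?thesis
    unfolding pgfr_unitary_cayley_iff_entries using n one neq
    by (intro conjI exI[of _ "\<lambda>_. t"] exI[of _ \<alpha>] exI[of _ \<beta>]) (auto simp: \<beta>_def)
qed

section \<open>Necessity: multiplicative relations between the limit phases\<close>

lemma exp_mult_minus_power_cancel:
  fixes z :: complex
  shows "exp (c * (- of_nat r * z)) * exp (c * z) ^ r = (1::complex)"
  by (simp add: exp_of_nat_mult[symmetric] exp_add[symmetric] algebra_simps)

lemma power_eq_1_coprime:
  fixes z :: "'a::field"
  assumes "z ^ p = 1" "z ^ q = 1" "coprime p q" "p > 0"
  shows "z = 1"
proof -
  obtain x y where "p * x = q * y + 1"
    using coprime_bezout_strong[of p q] assms by (metis coprime_commute power_0_left power_one_right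
        bezout_nat coprime_imp_gcd_eq_1 less_irrefl_nat)
  then have "(z ^ p) ^ x = (z ^ q) ^ y * z"
    by (metis power_add power_mult power_one_right)
  then show ?thesis using assms by simp
qed

text \<open>A relation c(i) = -r c(j) between eigenvalues gives a multiplicative relation between
  phases at every time, hence between their limits. Enough such relations exist to force equality
  when m is neither 1 nor prime.\<close>

lemma phase_limits_eq:
  fixes t :: "nat \<Rightarrow> real"
  assumes n: "n = 2 * m" "m > 0" and m: "m \<noteq> 1" "\<not> prime m"
    and lim: "\<And>j. (\<lambda>k. exp (- \<i> * of_real (t k) * ramanujan_sum n j))
                     \<longlonglongrightarrow> (if even j then \<gamma> else \<delta>)"
  shows "\<gamma> = \<delta>"
proof -
  define L where "L j = (if even j then \<gamma> else \<delta>)" for j :: int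
  have n0: "n > 0" using n by simp
  have mult_rel: "L i * L j ^ r = 1"
    if "ramanujan_sum n i = - of_nat r * ramanujan_sum n j" for i j r
  proof -
    have "(\<lambda>k. exp (- \<i> * of_real (t k) * ramanujan_sum n i) *
        exp (- \<i> * of_real (t k) * ramanujan_sum n j) ^ r) \<longlonglongrightarrow> L i * L j ^ r"
      unfolding L_def by (intro tendsto_mult tendsto_power lim)
    then show ?thesis
      unfolding that exp_mult_minus_power_cancel using LIMSEQ_const_iff by metis
  qed
  \<comment> \<open>A vanishing eigenvalue is the instance r = 0 of \<open>mult_rel\<close>.\<close>
  have zero: "L j = 1" if "ramanujan_sum n j = 0" for j
    using mult_rel[of j 0 j] that by simp
  have prime_rel: "L j ^ p = 1"
    if p: "prime p" "odd p" "p dvd n" "\<not> p * p dvd n" "\<not> int p dvd j" for p j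
  proof -
    obtain k where k: "n = p * k" using p by auto
    have "coprime p k"
      using p k by (intro prime_imp_coprime) auto
    then have "L (int p * j) * L j ^ (p - 1) = 1"
      unfolding k using p k n0 by (intro mult_rel[unfolded k] ramanujan_sum_prime_mult) auto
    \<comment> \<open>As p is odd, p j has the parity of j, so the relation becomes a p-th
      power.\<close>
    moreover have "L (int p * j) = L j" using p by (simp add: L_def)
    ultimately show ?thesis
      using p by (metis power_eq_if not_prime_0)
  qed
  have half_rel: "L (j + int m) * L j = 1" for j
    using mult_rel[of "j + int m" 1 j] ramanujan_sum_add_half[OF n(1) n0] by simp
  have square: "\<gamma> = \<delta>" if p: "prime p" "odd p" "p * p dvd n" for p
  proof -
    obtain q where q: "n = p * p * q" using p by auto
    \<comment> \<open>Translation by p q = n/p preserves the units, and p > 2 divides neither 1 nor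
      2; so one even and one odd eigenvalue vanish.\<close>
    have "L j = 1" if "j = 1 \<or> j = 2" for j
    proof (rule zero, rule ramanujan_sum_eq_0[OF n0, of "int p * int q"])
      show "int n dvd (int p * int q) ^ 3"
        by (simp add: q power3_eq_cube)
      have "p > 2" using p by (metis even_numeral le_neq_implies_less prime_ge_2_nat)
      then have "\<not> int p dvd j" using that by (auto dest: zdvd_imp_le)
      then show "\<not> int n dvd j * (int p * int q)"
        using q n0 by (auto simp: mult.assoc mult.left_commute)
    qed (simp add: q)
    from this[of 1] this[of 2] show ?thesis by (simp add: L_def)
  qed
  show ?thesis
  proof (cases "even m")
    case True
    then obtain k where k: "m = 2 * k" by auto
    \<comment> \<open>The value k = 1 would make m the prime 2.\<close>
    have "k > 1" using k n m by (cases "k = 1") auto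
    \<comment> \<open>4 divides n, so translation by n/2 preserves the units, and w^(n/2) =
      -1.\<close>
    have "L 1 = 1"
    proof (rule zero, rule ramanujan_sum_eq_0[OF n0, of "int m"])
      show "int n dvd int m ^ 3" by (simp add: n k power3_eq_cube)
    qed (use n in \<open>auto dest: zdvd_imp_le\<close>)
    then have "\<delta> = 1" by (simp add: L_def)
    have "\<gamma> = \<delta> \<or> L 2 = 1"
    proof (cases "even k")
      case True
      then obtain l where l: "k = 2 * l" by auto
      \<comment> \<open>8 divides n, so translation by n/4 is available, and w^(2n/4) = -1.\<close>
      have "L 2 = 1"
      proof (rule zero, rule ramanujan_sum_eq_0[OF n0, of "int k"])
        show "int n dvd int k ^ 3" by (simp add: n k l power3_eq_cube)
      qed (use n k in \<open>auto dest: zdvd_imp_le\<close>)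
      then show ?thesis ..
    next
      case False
      obtain p where p: "prime p" "p dvd k"
        using \<open>k > 1\<close> prime_factor_nat by (metis less_irrefl_nat)
      have "odd p" using p False by auto
      show ?thesis
      proof (cases "p * p dvd n")
        case True
        then show ?thesis using square p \<open>odd p\<close> by blast
      next
        case False
        have "p > 2" using p \<open>odd p\<close> by (metis even_numeral le_neq_implies_less prime_ge_2_nat)
        then have "\<not> int p dvd 2" by (auto dest: zdvd_imp_le)
        then have "L 2 ^ p = 1" using p \<open>odd p\<close> False n k by (intro prime_rel) auto
        \<comment> \<open>Since m is even, 2 + m is even too, and \<open>half_rel\<close> becomes a
          square.\<close>
        moreover have "L 2 ^ 2 = 1"
          using half_rel[of 2] k by (simp add: L_def power2_eq_square)
        ultimately have "L 2 = 1"
          by (rule power_eq_1_coprime) (use \<open>odd p\<close> p prime_gt_0_nat in simp_all)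
        then show ?thesis ..
      qed
    qed
    then show ?thesis using \<open>\<delta> = 1\<close> by (auto simp: L_def)
  next
    case False
    obtain p where p: "prime p" "p dvd m" using m prime_factor_nat by blast
    then obtain k where k: "m = p * k" by auto
    then have "k \<noteq> 1" using p m by auto
    then obtain q where q: "prime q" "q dvd k" using prime_factor_nat by blast
    have odd: "odd p" "odd q" using False k q by auto
    show ?thesis
    proof (cases "p * p dvd n \<or> q * q dvd n")
      case True
      then show ?thesis using square p q odd by blast
    next
      case False
      \<comment> \<open>The product p q divides n, so equal primes would fall under the square
        case.\<close>
      then have "p \<noteq> q" using k q n by (auto simp: mult_dvd_mono)
      have "\<not> int r dvd 1" if "prime r" for r using that by (auto dest: prime_gt_1_nat)
      then have "L 1 ^ p = 1" "L 1 ^ q = 1"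
        using p q odd False k n by (auto intro!: prime_rel)
      then have "L 1 = 1"
        by (rule power_eq_1_coprime) (use p q \<open>p \<noteq> q\<close> in \<open>simp_all add: prime_gt_0_nat primes_coprime\<close>)
      \<comment> \<open>Since m is odd, 1 + m is even, which transfers the value from \<delta> to
        \<gamma>.\<close>
      moreover have "L (1 + int m) = 1"
        using half_rel[of 1] \<open>L 1 = 1\<close> by simp
      ultimately show ?thesis using \<open>odd m\<close> by (simp add: L_def)
    qed
  qed
qed

text \<open>Equal eigenvalues at 1 and -1 force w^(2d) = 1 for d = b - a, and 0 < |d| < n leaves
  only 2d = n or 2d = -n. The conclusion is phrased through characters, which do not distinguish
  these two signs.\<close>

lemma pgfr_imp_even_antipodal:
  assumes n: "n > 1" and pgfr: "pgfr_from_to (unitary_cayley n) a b"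
  obtains m where "n = 2 * m" "\<And>j. root_char n (j * (int b - int a)) = root_char n (j * int m)"
proof -
  define d where "d = int b - int a"
  have ab: "a < n" "b < n" "b \<noteq> a"
    using pgfr unfolding pgfr_unitary_cayley_iff_entries by auto
  obtain t \<alpha> \<beta> where "\<beta> \<noteq> 0" and lim:
    "\<And>j. (\<lambda>k. exp (- \<i> * of_real (t k) * ramanujan_sum n j)) \<longlonglongrightarrow> \<alpha> + \<beta> * root_char n (j * d)"
    unfolding d_def using pgfr_phase_limit[OF n pgfr] by blast
  have "\<alpha> + \<beta> * root_char n (- 1 * d) = \<alpha> + \<beta> * root_char n (1 * d)"
  proof (rule LIMSEQ_unique[OF lim])
    show "(\<lambda>k. exp (- \<i> * of_real (t k) * ramanujan_sum n (- 1))) \<longlonglongrightarrow> \<alpha> + \<beta> * root_char n (1 * d)"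
      using lim[of 1] n by (subst ramanujan_sum_minus) simp_all
  qed
  then have "root_char n (- d) = root_char n d" using \<open>\<beta> \<noteq> 0\<close> by simp
  then have "root_char n (d + d) = 1"
    using root_char_add[of n d d] root_char_add[of n d "- d"] by simp
  then have "int n dvd 2 * d" using root_char_eq_1_iff n by simp
  then obtain c where c: "2 * d = int n * c" by auto
  have "\<bar>int n * c\<bar> < int n * 2" "c \<noteq> 0" using c ab by (auto simp: d_def)
  then have "\<bar>c\<bar> < 2" using n by (simp add: abs_mult)
  then have "c = 1 \<or> c = -1" using \<open>c \<noteq> 0\<close> by auto
  then have "even n" using c by (metis dvd_triv_left even_minus even_of_nat mult.right_neutral mult_minus_right)
  then obtain m where m: "n = 2 * m" by auto
  have "d = int m \<or> d = - int m" using c m \<open>c = 1 \<or> c = -1\<close> by auto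
  moreover have "root_char n (j * - int m) = root_char n (j * int m)" for j
    using root_char_half[OF m, of j] root_char_half[OF m, of "- j"] m n by simp
  ultimately have "root_char n (j * d) = root_char n (j * int m)" for j by auto
  then show thesis using m that unfolding d_def by blast
qed

lemma admits_pgfr_imp:
  assumes "n > 0" "admits_pgfr (unitary_cayley n)"
  shows "n = 2 \<or> (\<exists>p. prime p \<and> n = 2 * p)"
proof (rule ccontr)
  assume not: "\<not> ?thesis"
  obtain a b where pgfr: "pgfr_from_to (unitary_cayley n) a b"
    using assms(2) by (auto simp: admits_pgfr_def)
  then have n: "n > 1" by (auto simp: pgfr_unitary_cayley_iff_entries)
  obtain m where m: "n = 2 * m" and half: "\<And>j. root_char n (j * (int b - int a)) = root_char n (j * int m)"
    using pgfr_imp_even_antipodal[OF n pgfr] by blast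
  then have "m > 0" using n by simp
  obtain t \<alpha> \<beta> where "\<beta> \<noteq> 0" and lim:
    "\<And>j. (\<lambda>k. exp (- \<i> * of_real (t k) * ramanujan_sum n j)) \<longlonglongrightarrow> \<alpha> + \<beta> * root_char n (j * int m)"
    using pgfr_phase_limit[OF n pgfr] unfolding half by blast
  \<comment> \<open>The limits at even and odd j are \<alpha> + \<beta> and \<alpha> - \<beta>; the
    negated claim says that m is neither 1 nor prime.\<close>
  have "\<alpha> + \<beta> = \<alpha> - \<beta>"
  proof (rule phase_limits_eq[OF m \<open>m > 0\<close>])
    show "(\<lambda>k. exp (- \<i> * of_real (t k) * ramanujan_sum n j)) \<longlonglongrightarrow> (if even j then \<alpha> + \<beta> else \<alpha> - \<beta>)" for j
      using lim[of j] root_char_half[OF m \<open>m > 0\<close>, of j] by (cases "even j") simp_all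
  qed (use not m in auto)
  then show False using \<open>\<beta> \<noteq> 0\<close> by simp
qed

section \<open>Sufficiency: explicit revival times\<close>

lemma exp_minus_i_times: "exp (- \<i> * of_real t * of_real x) = cis (- (t * x))"
  by (simp add: cis_conv_exp mult.assoc)

text \<open>X_2 is a single edge, with eigenvalues 1 and -1.\<close>

lemma pgfr_unitary_cayley_2: "pgfr_from_to (unitary_cayley 2) 0 1"
proof (rule pgfr_antipodal[of 2 1])
  show "exp (- \<i> * of_real (pi / 2) * ramanujan_sum 2 j) = (if even j then - \<i> else \<i>)" for j
  proof -
    have "{..<2::nat} = {0, 1}" by auto
    then have "ramanujan_sum 2 j = root_char 2 j" by (simp add: ramanujan_sum_def)
    also have "\<dots> = (if even j then 1 else -1)" using root_char_half[of 2 1 j] by simp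
    finally have "ramanujan_sum 2 j = of_real (if even j then 1 else -1)" by simp
    then show ?thesis by (simp only: exp_minus_i_times) simp
  qed
qed (auto simp: complex_eq_iff)

text \<open>X_4 is the 4-cycle, with eigenvalues 2, 0, -2, 0; at pi/2 both 2 and -2 give the phase
  -1.\<close>

lemma pgfr_unitary_cayley_4: "pgfr_from_to (unitary_cayley 4) 0 2"
proof (rule pgfr_antipodal[of 4 2])
  show "exp (- \<i> * of_real (pi / 2) * ramanujan_sum 4 j) = (if even j then -1 else 1)" for j
  proof (cases "even j")
    case True
    then obtain i where i: "j = 2 * i" by auto
    have "{..<4::nat} = {0, 1, 2, 3}" by auto
    moreover have "coprime (3::int) 4" using coprime_diff_one_left[of "4::int"] by simp
    moreover have "\<not> coprime (2::int) 4" by simp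
    ultimately have "ramanujan_sum 4 j = root_char 4 (i * 2) + root_char 4 ((i * 3) * 2)"
      by (simp add: ramanujan_sum_def i mult_ac)
    also have "\<dots> = (if even i then 2 else -2)"
      using root_char_half[of 4 2 i] root_char_half[of 4 2 "i * 3"] by simp
    finally have "ramanujan_sum 4 j = of_real (if even i then 2 else -2)" by simp
    then show ?thesis using True by (simp only: exp_minus_i_times) (simp add: complex_eq_iff)
  next
    case False
    then have "\<not> 4 dvd j * 2" by presburger
    then have "ramanujan_sum 4 j = 0"
      by (intro ramanujan_sum_eq_0[of 4 2]) simp_all
    then show ?thesis using False by simp
  qed
qed auto

text \<open>Multiples of p reduce modulo 2p to 0 or p, where the values are the totient and its
  negative. For other j, c(pj) = -(p-1) c(j) is solved for c(j).\<close>

lemma ramanujan_sum_twice_prime: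
  assumes p: "prime p" "odd p"
  shows "ramanujan_sum (2 * p) j = (if int p dvd j then of_nat (p - 1) else -1) * (if even j then 1 else -1)"
proof -
  have p1: "p > 1" using p prime_gt_1_nat by blast
  have "coprime p 2" using p by simp
  then have "totient (2 * p) = p - 1"
    using p by (simp add: totient_mult_coprime coprime_commute totient_prime)
  then have R0: "ramanujan_sum (2 * p) 0 = of_nat (p - 1)"
    using ramanujan_sum_0[of "2 * p"] p1 by simp
  have Rp: "ramanujan_sum (2 * p) (int p) = - of_nat (p - 1)"
    using ramanujan_sum_add_half[of "2 * p" p 0] R0 p1 by simp
  have mult: "ramanujan_sum (2 * p) (int p * i) = of_nat (p - 1) * (if even i then 1 else -1)" for i
  proof (cases "even i")
    case True
    then have "[int p * i = 0] (mod int (2 * p))" by (auto simp: cong_0_iff)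
    then show ?thesis using ramanujan_sum_cong[of "2 * p"] R0 p1 True by simp
  next
    case False
    then obtain k where "i = 2 * k + 1" by (elim oddE)
    then have "int p * i - int p = int (2 * p) * k" by (simp add: algebra_simps)
    then have "[int p * i = int p] (mod int (2 * p))" by (simp add: cong_iff_dvd_diff)
    then show ?thesis using ramanujan_sum_cong[of "2 * p"] Rp p1 False by simp
  qed
  show ?thesis
  proof (cases "int p dvd j")
    case True
    then obtain i where "j = int p * i" by auto
    then show ?thesis using mult[of i] p by simp
  next
    case False
    have "of_nat (p - 1) * (if even j then 1 else -1) = - of_nat (p - 1) * ramanujan_sum (2 * p) j"
      using ramanujan_sum_prime_mult[of p 2 j] False p \<open>coprime p 2\<close> mult[of j]
      by (simp add: mult.commute)
    moreover have "(of_nat (p - 1) :: complex) \<noteq> 0" using p1 by simp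
    ultimately have "ramanujan_sum (2 * p) j = - (if even j then 1 else -1)"
      by (metis minus_mult_commute mult_left_cancel minus_minus)
    then show ?thesis using False by simp
  qed
qed

text \<open>Within each parity class of j the two eigenvalues differ by p, so t p = 2 pi makes their
  phases agree.\<close>

lemma pgfr_unitary_cayley_twice_odd_prime:
  assumes p: "prime p" "odd p"
  shows "pgfr_from_to (unitary_cayley (2 * p)) 0 p"
proof -
  define t where "t = 2 * pi / real p"
  have p2: "p > 2" using p by (metis even_numeral le_neq_implies_less prime_ge_2_nat)
  have tp: "t * real p = 2 * pi" using p2 by (simp add: t_def)
  show ?thesis
  proof (rule pgfr_antipodal[of _ p t "cis t" "cis (- t)"])
    show "exp (- \<i> * of_real t * ramanujan_sum (2 * p) j) = (if even j then cis t else cis (- t))" for j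
    proof -
      have "ramanujan_sum (2 * p) j
          = of_real ((if int p dvd j then real (p - 1) else -1) * (if even j then 1 else -1))"
        unfolding ramanujan_sum_twice_prime[OF p] by simp
      moreover have "t * real (p - 1) = 2 * pi - t"
        using p2 tp by (simp add: of_nat_diff right_diff_distrib)
      moreover have "cis (2 * pi - t) = cis (- t)" "cis (t - 2 * pi) = cis t"
        by (simp_all add: complex_eq_iff cos_diff sin_diff)
      ultimately show ?thesis by (simp only: exp_minus_i_times) simp
    qed
    \<comment> \<open>The two phases are conjugate, so they differ once sin t is nonzero.\<close>
    have "0 < t" "t < pi" using p2 by (auto simp: t_def field_simps)
    then have "sin t > 0" by (rule sin_gt_zero)
    then show "cis t \<noteq> cis (- t)" by (auto simp: complex_eq_iff)
  qed (use p2 in auto)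
qed

theorem theorem3p8:
  fixes n :: nat
  assumes "n > 0"
  shows "admits_pgfr (unitary_cayley n) \<longleftrightarrow> n = 2 \<or> (\<exists>p::nat. prime p \<and> n = 2 * p)"
proof
  assume "n = 2 \<or> (\<exists>p::nat. prime p \<and> n = 2 * p)"
  then have "n = 2 \<or> n = 4 \<or> (\<exists>p. prime p \<and> odd p \<and> n = 2 * p)"
    \<comment> \<open>The only even prime is 2, which accounts for n = 4.\<close>
    by (auto dest: primes_dvd_imp_eq[OF two_is_prime_nat])
  then obtain b where "pgfr_from_to (unitary_cayley n) 0 b"
    using pgfr_unitary_cayley_2 pgfr_unitary_cayley_4 pgfr_unitary_cayley_twice_odd_prime by auto
  then show "admits_pgfr (unitary_cayley n)"
    unfolding admits_pgfr_def by blast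
qed (rule admits_pgfr_imp[OF assms])

end
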